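(* Let an input-output process with finite input alphabet $\mathcal X$, finite output alphabet $\mathcal Y$ and finitely many causal states $s_0,\dots,s_{n-1}$ be given, and let $|s_0\rangle,\dots,|s_{n-1}\rangle$ be its quantum causal states. Then a quantum system initialized in $|s_i\rangle$ can generate correct future statistical behaviour for every past in $s_i$. That is, there exists a family of quantum operations $\{\mathcal M_x\}_{x\in\mathcal X}$ with classical output (for each $x$, a quantum instrument $\mathcal M_x=\{\mathcal M_x^{y}\}_{y\in\mathcal Y}$: completely positive maps whose sum over $y$ is trace preserving) on the memory system, not depending on $i$ or on the past, such that for every $i$, every past $\overleftarrow z\in s_i$, every $x\in\mathcal X$ and every $y\in\mathcal Y$: $\mathcal M_x$ applied to $|s_i\rangle\langle s_i|$ outputs $y$ with probability $P[Y^{(0)}=y\mid X^{(0)}=x,\overleftarrow Z=\overleftarrow z]$ and, when this probability is non-zero, conditionally on output $y$ leaves the memory in the state $|\varepsilon(\mu_{x,y}(\overleftarrow z))\rangle$ (where $|\varepsilon(\overleftarrow z')\rangle:=|s_k\rangle$ if $\varepsilon(\overleftarrow z')=s_k$). Consequently, for each future input sequence $\overrightarrow x=x^{(0)}x^{(1)}\cdots$, the sequential application of $\mathcal M_{x^{(0)}},\mathcal M_{x^{(1)}},\dots$ to a system initialized in $|s_i\rangle$ generates an output sequence $\overrightarrow y$ distributed according to $P[\overrightarrow Y\mid\overrightarrow X=\overrightarrow x,\overleftarrow Z=\overleftarrow z]$.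
   Context: Input-output process. $\mathcal X$ and $\mathcal Y$ are finite alphabets. An input-output process is a family of laws of bi-infinite output sequences $\overleftrightarrow Y=\cdots Y^{(-1)}Y^{(0)}Y^{(1)}\cdots$ over $\mathcal Y$, one for each bi-infinite input sequence $\overleftrightarrow x$ over $\mathcal X$, which is stationary (invariant under simultaneous time translation of inputs and outputs) and causal (outputs up to time $t$ do not depend on inputs after time $t$). A past is a pair $\overleftarrow z=(\overleftarrow x,\overleftarrow y)$ with $\overleftarrow x=\cdots x^{(-2)}x^{(-1)}$, $\overleftarrow y=\cdots y^{(-2)}y^{(-1)}$; futures are $\overrightarrow x=x^{(0)}x^{(1)}\cdots$, $\overrightarrow y=y^{(0)}y^{(1)}\cdots$. The process assigns to each past $\overleftarrow z$ and future input $\overrightarrow x$ a conditional law $P[\overrightarrow Y\mid\overrightarrow X=\overrightarrow x,\overleftarrow Z=\overleftarrow z]$ of the future output. Write $\mu_{x,y}(\overleftarrow z)=(\overleftarrow x x,\overleftarrow y y)$ for the past updated by one further input-output pair $(x,y)$. The conditional law is obtained by iterating the one-step probabilities: on input $x^{(0)}$ the output is $y^{(0)}$ with probability $P[Y^{(0)}=y^{(0)}\mid X^{(0)}=x^{(0)},\overleftarrow Z=\overleftarrow z]$, the past then becomes $\mu_{x^{(0)},y^{(0)}}(\overleftarrow z)$, and so on. Causal states. Two pasts are equivalent, $\overleftarrow z\sim_\varepsilon\overleftarrow z'$, if $P[\overrightarrow Y\mid\overrightarrow X=\overrightarrow x,\overleftarrow Z=\overleftarrow z]=P[\overrightarrow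 Y\mid\overrightarrow X=\overrightarrow x,\overleftarrow Z=\overleftarrow z']$ for all future inputs $\overrightarrow x$. The equivalence classes $\mathcal S=\{s_0,\dots,s_{n-1}\}$ are the causal states, and $\varepsilon$ maps each past to its class. The transition elements are $T_{ij}^{y|x}=P[S^{(t)}=s_j,Y^{(t)}=y\mid S^{(t-1)}=s_i,X^{(t)}=x]$, where $S^{(t)}$ is the causal state of the past that includes time $t$; that is, for any $\overleftarrow z\in s_i$, $T_{ij}^{y|x}=P[Y^{(0)}=y\mid X^{(0)}=x,\overleftarrow Z=\overleftarrow z]$ if $\varepsilon(\mu_{x,y}(\overleftarrow z))=s_j$, and $T_{ij}^{y|x}=0$ otherwise. Quantum causal states. Let $\{|y\rangle\}_{y\in\mathcal Y}$ and $\{|k\rangle\}_{k=0}^{n-1}$ be orthonormal bases of spaces of dimension $|\mathcal Y|$ and $n$. Define $|s_i^x\rangle=\sum_{k}\sum_{y}\sqrt{T_{ik}^{y|x}}\,|y\rangle|k\rangle$ and $|s_i\rangle=\bigotimes_{x\in\mathcal X}|s_i^x\rangle$, a vector in $(\mathbb C^{|\mathcal Y|}\otimes\mathbb C^{n})^{\otimes|\mathcal X|}$; this space is the memory system. *)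

theory Defs
  imports "HOL-Probability.Probability"
begin

section \<open>Input-output processes\<close>

text \<open>
  One-sided sequences: in a past, the entry with index \<open>k\<close> belongs to time \<open>- k - 1\<close>;
  in a future, the entry with index \<open>k\<close> belongs to time \<open>k\<close>.
\<close>

type_synonym ('x, 'y) past = "(nat \<Rightarrow> 'x) \<times> (nat \<Rightarrow> 'y)"

definition past_of :: "(int \<Rightarrow> 'a) \<Rightarrow> nat \<Rightarrow> 'a" where
  "past_of w = (\<lambda>k. w (- int k - 1))"

definition future_of :: "(int \<Rightarrow> 'a) \<Rightarrow> nat \<Rightarrow> 'a" where
  "future_of w = (\<lambda>k. w (int k))"

definition time_shift :: "(int \<Rightarrow> 'a) \<Rightarrow> int \<Rightarrow> 'a" where
  "time_shift w = (\<lambda>t. w (t + 1))"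

abbreviation seq_space :: "('i \<Rightarrow> 'a) measure" where
  "seq_space \<equiv> PiM UNIV (\<lambda>_. count_space UNIV)"

definition update_past :: "'x \<Rightarrow> 'y \<Rightarrow> ('x, 'y) past \<Rightarrow> ('x, 'y) past" where
  "update_past x y z = (case_nat x (fst z), case_nat y (snd z))"

primrec past_after ::
  "('x, 'y) past \<Rightarrow> (nat \<Rightarrow> 'x) \<Rightarrow> (nat \<Rightarrow> 'y) \<Rightarrow> nat \<Rightarrow> ('x, 'y) past" where
  "past_after z xs ys 0 = z"
| "past_after z xs ys (Suc n) = update_past (xs n) (ys n) (past_after z xs ys n)"

text \<open>
  The law of the future output given a past \<open>z\<close> and a future input \<open>xs\<close>, obtained by iterating
  the one-step probabilities \<open>p z x\<close>. The library's Ionescu-Tulcea construction provides the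
  measure; its values on cylinders are computed in \<open>measure_cond_law_cylinder\<close> below.
\<close>

definition future_kernel ::
  "(('x, 'y) past \<Rightarrow> 'x \<Rightarrow> 'y pmf) \<Rightarrow> ('x, 'y) past \<Rightarrow> (nat \<Rightarrow> 'x)
    \<Rightarrow> nat \<Rightarrow> (nat \<Rightarrow> 'y) \<Rightarrow> 'y measure" where
  "future_kernel p z xs n ys = measure_pmf (p (past_after z xs ys n) (xs n))"

definition cond_law ::
  "(('x, 'y) past \<Rightarrow> 'x \<Rightarrow> 'y pmf) \<Rightarrow> ('x, 'y) past \<Rightarrow> (nat \<Rightarrow> 'x) \<Rightarrow> (nat \<Rightarrow> 'y) measure" where
  "cond_law p z xs =
     projective_family.lim UNIV
       (Ionescu_Tulcea.CI (future_kernel p z xs) (\<lambda>_. count_space UNIV)) (\<lambda>_. count_space UNIV)"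

lemma past_after_cong: "(\<And>t. t < n \<Longrightarrow> ys t = ys' t) \<Longrightarrow> past_after z xs ys n = past_after z xs ys' n"
  by (induction n) auto

lemma Ionescu_Tulcea_future_kernel:
  fixes p :: "('x, 'y::finite) past \<Rightarrow> 'x \<Rightarrow> 'y pmf"
  shows "Ionescu_Tulcea (future_kernel p z xs) (\<lambda>_. count_space UNIV)"
proof (rule Ionescu_Tulcea.intro)
  fix i :: nat
  have "PiM {0..<i} (\<lambda>_. count_space (UNIV :: 'y set)) = count_space (PiE {0..<i} (\<lambda>_. UNIV))"
    by (rule count_space_PiM_finite) auto
  moreover have "future_kernel p z xs i w \<in> space (subprob_algebra (count_space UNIV))" for w
    by (simp add: future_kernel_def measure_pmf_in_subprob_space)
  ultimately show "future_kernel p z xs i \<in>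
      measurable (PiM {0..<i} (\<lambda>_. count_space UNIV)) (subprob_algebra (count_space UNIV))"
    by simp
next
  fix i :: nat and w :: "nat \<Rightarrow> 'y"
  show "prob_space (future_kernel p z xs i w)"
    unfolding future_kernel_def by (rule prob_space_measure_pmf)
qed

lemma
  fixes p :: "('x, 'y::finite) past \<Rightarrow> 'x \<Rightarrow> 'y pmf"
  shows prob_space_cond_law: "prob_space (cond_law p z xs)"
    and sets_cond_law: "sets (cond_law p z xs) = sets seq_space"
    and measure_cond_law_cylinder:
      "measure (cond_law p z xs) {ys. \<forall>t<n. ys t = w t} =
         (\<Prod>t<n. pmf (p (past_after z xs w t) (xs t)) (w t))"
proof -
  let ?M = "\<lambda>_::nat. count_space (UNIV :: 'y set)"
  interpret IT: Ionescu_Tulcea "future_kernel p z xs" ?M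
    by (rule Ionescu_Tulcea_future_kernel)
  have cl: "cond_law p z xs = IT.PF.lim"
    by (simp add: cond_law_def)
  show st: "sets (cond_law p z xs) = sets seq_space"
    unfolding cl by (rule IT.PF.sets_lim)
  have PiM_eq: "PiM {0..<i} ?M = count_space (PiE {0..<i} (\<lambda>_. UNIV))" for i
    by (rule count_space_PiM_finite) auto
  let ?u = "\<lambda>_::nat. undefined :: 'y"
  have u: "?u \<in> space (PiM {0..<0} ?M)"
    by (simp add: PiM_eq)
  have C: "IT.C 0 n ?u {restrict w {0..<n}} =
      ennreal (\<Prod>t<n. pmf (p (past_after z xs w t) (xs t)) (w t))" for n
  proof (induction n)
    case 0
    have "restrict w {} = ?u" by auto
    moreover have "{?u} \<in> sets (PiM {} ?M)"
      using PiM_eq[of 0] by simp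
    ultimately show ?case by simp
  next
    case (Suc n)
    let ?c = "ennreal (pmf (p (past_after z xs w n) (xs n)) (w n))"
    have spC: "space (IT.C 0 n ?u) = space (PiM {0..<n} ?M)"
      using IT.space_C[of ?u 0 n] u by simp
    have stC: "sets (IT.C 0 n ?u) = sets (PiM {0..<n} ?M)"
      using IT.sets_C[of ?u 0 n] u by simp
    have in_sets: "{restrict w {0..<i}} \<in> sets (PiM {0..<i} ?M)" for i
      by (simp add: PiM_eq)
    have eP: "IT.eP n x {restrict w {0..<Suc n}} = ?c * indicator {restrict w {0..<n}} x"
      if x: "x \<in> space (PiM {0..<n} ?M)" for x
    proof -
      have ext: "x \<in> extensional {0..<n}" using x by (auto simp: PiM_eq PiE_def)
      have set_eq: "(\<lambda>v. x(n := v)) -` {restrict w {0..<Suc n}} =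
          (if x = restrict w {0..<n} then {w n} else {})"
      proof (cases "x = restrict w {0..<n}")
        case True
        have "(x(n := v) = restrict w {0..<Suc n}) = (v = w n)" for v
        proof
          assume "x(n := v) = restrict w {0..<Suc n}"
          from fun_cong[OF this, of n] show "v = w n" by simp
        qed (auto simp: True fun_eq_iff)
        with True show ?thesis by auto
      next
        case False
        then obtain j where j: "x j \<noteq> restrict w {0..<n} j"
          unfolding fun_eq_iff by blast
        then have "j < n" using ext by (auto simp: extensional_def split: if_splits)
        then have "x(n := v) \<noteq> restrict w {0..<Suc n}" for v
          using j by (auto simp: fun_eq_iff intro!: exI[of _ j])
        then show ?thesis using False by auto
      qed
      have "IT.eP n x {restrict w {0..<Suc n}} =
          future_kernel p z xs n x ((\<lambda>v. x(n := v)) -` {restrict w {0..<Suc n}})"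
        using IT.emeasure_eP[OF x in_sets[of "Suc n"]] by simp
      also have "\<dots> = ?c * indicator {restrict w {0..<n}} x"
      proof (cases "x = restrict w {0..<n}")
        case True
        have "past_after z xs x n = past_after z xs w n"
          by (rule past_after_cong) (simp add: True)
        then show ?thesis
          unfolding set_eq by (simp add: True future_kernel_def emeasure_pmf_single)
      next
        case False
        then show ?thesis unfolding set_eq by simp
      qed
      finally show ?thesis .
    qed
    have "IT.C 0 (Suc n) ?u {restrict w {0..<Suc n}} =
        (\<integral>\<^sup>+x. IT.eP n x {restrict w {0..<Suc n}} \<partial>IT.C 0 n ?u)"
      unfolding IT.C.simps
      apply (subst emeasure_bind[where N = "PiM {0..<Suc n} ?M"])
      subgoal by (simp add: spC PiM_eq PiE_eq_empty_iff)
      subgoal using IT.measurable_eP[of n] by (simp add: measurable_cong_sets[OF stC refl])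
      subgoal by (rule in_sets)
      by simp
    also have "\<dots> = (\<integral>\<^sup>+x. ?c * indicator {restrict w {0..<n}} x \<partial>IT.C 0 n ?u)"
      by (rule nn_integral_cong) (simp add: eP spC)
    also have "\<dots> = ?c * IT.C 0 n ?u {restrict w {0..<n}}"
      by (rule nn_integral_cmult_indicator) (simp add: stC in_sets)
    finally show ?case
      by (simp only: Suc.IH prod.lessThan_Suc) (simp add: ennreal_mult'' mult.commute prod_nonneg)
  qed
  have "{restrict w {0..<n}} \<in> sets (PiM {0..<n} ?M)" for n
    by (simp add: PiM_eq)
  then have "emeasure (cond_law p z xs) (IT.PF.emb UNIV {0..<n} {restrict w {0..<n}}) =
      ennreal (\<Prod>t<n. pmf (p (past_after z xs w t) (xs t)) (w t))" for n
    unfolding cl by (subst IT.lim) (auto simp: IT.emeasure_CI[of _ n] prod_emb_id C)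
  moreover have "IT.PF.emb UNIV {0..<n} {restrict w {0..<n}} = {ys. \<forall>t<n. ys t = w t}" for n
    unfolding prod_emb_def by (auto simp: space_PiM restrict_def dest: fun_cong split: if_splits)
       (metis (full_types))
  ultimately have cyl: "emeasure (cond_law p z xs) {ys. \<forall>t<n. ys t = w t} =
      ennreal (\<Prod>t<n. pmf (p (past_after z xs w t) (xs t)) (w t))" for n
    by metis
  have "space (cond_law p z xs) = UNIV"
    using sets_eq_imp_space_eq[OF st] by (simp add: space_PiM)
  then show "prob_space (cond_law p z xs)"
    using cyl[of 0] by (intro prob_spaceI) simp
  show "measure (cond_law p z xs) {ys. \<forall>t<n. ys t = w t} =
      (\<Prod>t<n. pmf (p (past_after z xs w t) (xs t)) (w t))"
    using cyl[of n] by (simp add: measure_def prod_nonneg)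
qed

text \<open>
  A process consists of the laws of the bi-infinite output sequences together with the one-step
  conditional probabilities. The latter are part of the data because they are needed for every
  past, including pasts in null sets; \<open>disintegration\<close> says that the resulting \<open>cond_law\<close> is a
  regular conditional law of the future output given the past. By \<open>stationary\<close> it suffices to
  require this at time 0.
\<close>

locale io_process =
  fixes law :: "(int \<Rightarrow> 'x::finite) \<Rightarrow> (int \<Rightarrow> 'y::finite) measure"
    and p :: "('x, 'y) past \<Rightarrow> 'x \<Rightarrow> 'y pmf"
  assumes prob_space_law: "prob_space (law x)"
    and sets_law: "sets (law x) = sets seq_space"
    and stationary: "law (time_shift x) = distr (law x) seq_space time_shift"
    and causal: "(\<And>s. s \<le> t \<Longrightarrow> x s = x' s) \<Longrightarrow>
      distr (law x) (PiM {..t} (\<lambda>_. count_space UNIV)) (\<lambda>w. restrict w {..t}) =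
      distr (law x') (PiM {..t} (\<lambda>_. count_space UNIV)) (\<lambda>w. restrict w {..t})"
    and measurable_step: "(\<lambda>yp. pmf (p (xp, yp) a) b) \<in> borel_measurable seq_space"
    and disintegration: "A \<in> sets seq_space \<Longrightarrow> B \<in> sets seq_space \<Longrightarrow>
      emeasure (law x) {w \<in> space (law x). past_of w \<in> A \<and> future_of w \<in> B} =
      (\<integral>\<^sup>+ w. indicator A (past_of w) *
         emeasure (cond_law p (past_of x, past_of w) (future_of x)) B \<partial>law x)"


section \<open>Causal states\<close>

definition causal_equiv ::
  "(('x, 'y) past \<Rightarrow> 'x \<Rightarrow> 'y pmf) \<Rightarrow> (('x, 'y) past \<times> ('x, 'y) past) set" where
  "causal_equiv p = {(z, z'). \<forall>xs. cond_law p z xs = cond_law p z' xs}"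

definition causal_states :: "(('x, 'y) past \<Rightarrow> 'x \<Rightarrow> 'y pmf) \<Rightarrow> ('x, 'y) past set set" where
  "causal_states p = UNIV // causal_equiv p"

definition causal_map ::
  "(('x, 'y) past \<Rightarrow> 'x \<Rightarrow> 'y pmf) \<Rightarrow> ('x, 'y) past \<Rightarrow> ('x, 'y) past set" where
  "causal_map p z = causal_equiv p `` {z}"

text \<open>
  The enumeration of the causal states is a function \<open>s\<close> on a finite index type.
  The transition element is independent of the chosen representative: see \<open>transition_eq\<close>.
\<close>

definition transition ::
  "(('x, 'y) past \<Rightarrow> 'x \<Rightarrow> 'y pmf) \<Rightarrow> ('k \<Rightarrow> ('x, 'y) past set) \<Rightarrow> 'k \<Rightarrow> 'k \<Rightarrow> 'y \<Rightarrow> 'x \<Rightarrow> real" where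
  "transition p s i j y x =
     (let z = (SOME z. z \<in> s i)
      in if causal_map p (update_past x y z) = s j then pmf (p z x) y else 0)"

lemma cond_law_eqI:
  fixes p :: "('x, 'y::finite) past \<Rightarrow> 'x \<Rightarrow> 'y pmf"
  assumes "\<And>n w. measure (cond_law p z xs) {ys. \<forall>t<n. ys t = w t} =
    measure (cond_law p z' xs) {ys. \<forall>t<n. ys t = w t}"
  shows "cond_law p z xs = cond_law p z' xs"
proof (rule measure_eqI_PiM_infinite[where I = UNIV and M = "\<lambda>_. count_space UNIV"])
  interpret L: prob_space "cond_law p z xs" by (rule prob_space_cond_law)
  interpret L': prob_space "cond_law p z' xs" by (rule prob_space_cond_law)
  note sets_cond_law[measurable_cong]
  show "sets (cond_law p z xs) = sets seq_space" "sets (cond_law p z' xs) = sets seq_space"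
    by (rule sets_cond_law)+
  show "finite_measure (cond_law p z xs)" by unfold_locales
  fix A :: "nat \<Rightarrow> 'y set" and J :: "nat set"
  assume J: "finite J"
  obtain n where n: "J \<subseteq> {..<n}" using J by (meson finite_nat_iff_bounded)
  let ?E = "prod_emb UNIV (\<lambda>_. count_space UNIV) J (Pi\<^sub>E J A)"
  define W where "W = {w \<in> PiE {..<n} (\<lambda>_. UNIV :: 'y set). \<forall>t\<in>J. w t \<in> A t}"
  let ?cyl = "\<lambda>w :: nat \<Rightarrow> 'y. {ys. \<forall>t<n. ys t = w t}"
  have "finite W"
    unfolding W_def by (rule finite_subset[OF _ finite_PiE[of "{..<n}" "\<lambda>_. UNIV"]]) auto
  have E: "?E = (\<Union>w\<in>W. ?cyl w)"
  proof (intro set_eqI iffI)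
    fix ys assume "ys \<in> ?E"
    then have "\<forall>t\<in>J. ys t \<in> A t" by (auto simp: prod_emb_def PiE_iff)
    then have "restrict ys {..<n} \<in> W" using n by (auto simp: W_def)
    then show "ys \<in> (\<Union>w\<in>W. ?cyl w)" by (rule UN_I) simp
  next
    fix ys assume "ys \<in> (\<Union>w\<in>W. ?cyl w)"
    then show "ys \<in> ?E" using n by (auto simp: W_def prod_emb_def PiE_iff space_PiM subset_eq)
  qed
  have disj: "disjoint_family_on ?cyl W"
    unfolding disjoint_family_on_def
  proof (intro ballI impI)
    fix w w' assume w: "w \<in> W" "w' \<in> W" "w \<noteq> w'"
    have "w = w'" if "ys \<in> ?cyl w \<inter> ?cyl w'" for ys
      using that w(1,2) by (intro PiE_ext[of w "{..<n}" "\<lambda>_. UNIV"]) (auto simp: W_def)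
    with w(3) show "?cyl w \<inter> ?cyl w' = {}" by blast
  qed
  have cyl: "?cyl w \<in> sets seq_space" for w
  proof -
    have "{ys \<in> space seq_space. \<forall>t<n. ys t = w t} \<in> sets seq_space" by measurable
    then show ?thesis by (simp add: space_PiM)
  qed
  have "measure (cond_law p z xs) ?E = measure (cond_law p z' xs) ?E"
    unfolding E
    by (subst L.finite_measure_finite_Union[OF \<open>finite W\<close> _ disj]; (subst L'.finite_measure_finite_Union[OF \<open>finite W\<close> _ disj])?)
       (auto simp: sets_cond_law cyl assms)
  then show "emeasure (cond_law p z xs) ?E = emeasure (cond_law p z' xs) ?E"
    by (simp add: L.emeasure_eq_measure L'.emeasure_eq_measure)
qed

lemma past_after_Suc:
  "past_after z xs ys (Suc n) =
     past_after (update_past (xs 0) (ys 0) z) (\<lambda>t. xs (Suc t)) (\<lambda>t. ys (Suc t)) n"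
  by (induction n) auto

lemma causal_equiv_step:
  fixes p :: "('x, 'y::finite) past \<Rightarrow> 'x \<Rightarrow> 'y pmf"
  assumes "(z, z') \<in> causal_equiv p"
  shows "p z x = p z' x"
proof (rule pmf_eqI)
  fix y
  have "cond_law p z (\<lambda>_. x) = cond_law p z' (\<lambda>_. x)"
    using assms by (simp add: causal_equiv_def)
  then show "pmf (p z x) y = pmf (p z' x) y"
    using measure_cond_law_cylinder[of p z "\<lambda>_. x" 1 "\<lambda>_. y"]
      measure_cond_law_cylinder[of p z' "\<lambda>_. x" 1 "\<lambda>_. y"] by simp
qed

lemma causal_equiv_update:
  fixes p :: "('x, 'y::finite) past \<Rightarrow> 'x \<Rightarrow> 'y pmf"
  assumes zz': "(z, z') \<in> causal_equiv p" and pos: "pmf (p z x) y \<noteq> 0"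
  shows "(update_past x y z, update_past x y z') \<in> causal_equiv p"
  unfolding causal_equiv_def
proof (clarify, rule cond_law_eqI)
  fix xs n w
  have *: "measure (cond_law p v (case_nat x xs)) {ys. \<forall>t<Suc n. ys t = case_nat y w t} =
      pmf (p v x) y * measure (cond_law p (update_past x y v) xs) {ys. \<forall>t<n. ys t = w t}" for v
    unfolding measure_cond_law_cylinder prod.lessThan_Suc_shift past_after_Suc by simp
  have "cond_law p z (case_nat x xs) = cond_law p z' (case_nat x xs)"
    using zz' by (simp add: causal_equiv_def)
  then have "pmf (p z x) y * measure (cond_law p (update_past x y z) xs) {ys. \<forall>t<n. ys t = w t} =
      pmf (p z x) y * measure (cond_law p (update_past x y z') xs) {ys. \<forall>t<n. ys t = w t}"
    unfolding *[of z, symmetric] by (simp only: * causal_equiv_step[OF zz'])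
  then show "measure (cond_law p (update_past x y z) xs) {ys. \<forall>t<n. ys t = w t} =
      measure (cond_law p (update_past x y z') xs) {ys. \<forall>t<n. ys t = w t}"
    using pos by simp
qed

lemma equiv_causal_equiv: "equiv UNIV (causal_equiv p)"
  by (auto simp: equiv_def refl_on_def sym_def trans_def causal_equiv_def)

lemma transition_eq:
  fixes p :: "('x, 'y::finite) past \<Rightarrow> 'x \<Rightarrow> 'y pmf"
  assumes s: "s i \<in> causal_states p" and z: "z \<in> s i"
  shows "transition p s i j y x =
    (if causal_map p (update_past x y z) = s j then pmf (p z x) y else 0)"
proof -
  define z' where "z' = (SOME z. z \<in> s i)"
  have "z' \<in> s i" unfolding z'_def using z by (rule someI)
  with s z have eq: "(z, z') \<in> causal_equiv p"
    using quotient_eq_iff[OF equiv_causal_equiv[of p], of "s i" "s i"]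
    by (auto simp: causal_states_def)
  have "causal_map p (update_past x y z) = causal_map p (update_past x y z')"
    if "pmf (p z x) y \<noteq> 0"
    unfolding causal_map_def
    by (rule equiv_class_eq[OF equiv_causal_equiv causal_equiv_update[OF eq that]])
  then show ?thesis
    using causal_equiv_step[OF eq, of x] by (auto simp: transition_def z'_def[symmetric])
qed


section \<open>Quantum states and instruments\<close>

text \<open>
  Tensor products are written in coordinates: \<open>complex ^ ('y \<times> 'k)\<close> is the tensor product of
  \<open>complex ^ 'y\<close> and \<open>complex ^ 'k\<close>, with \<open>axis (y, k) 1\<close> the product of the basis vectors, and
  \<open>complex ^ ('x \<Rightarrow> 'a)\<close> is the tensor power of \<open>complex ^ 'a\<close> with one factor for each element
  of \<open>'x\<close>.
\<close>

definition tensor :: "('x::finite \<Rightarrow> complex ^ 'a::finite) \<Rightarrow> complex ^ ('x \<Rightarrow> 'a)" where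
  "tensor v = (\<chi> f. \<Prod>x\<in>UNIV. v x $ f x)"

type_synonym ('x, 'y, 'k) memory = "complex ^ ('x \<Rightarrow> 'y \<times> 'k)"

definition qstate_factor ::
  "(('x, 'y::finite) past \<Rightarrow> 'x \<Rightarrow> 'y pmf) \<Rightarrow> ('k::finite \<Rightarrow> ('x, 'y) past set)
    \<Rightarrow> 'k \<Rightarrow> 'x \<Rightarrow> complex ^ ('y \<times> 'k)" where
  "qstate_factor p s i x =
     (\<Sum>k\<in>UNIV. \<Sum>y\<in>UNIV. complex_of_real (sqrt (transition p s i k y x)) *s axis (y, k) 1)"

definition qstate ::
  "(('x::finite, 'y::finite) past \<Rightarrow> 'x \<Rightarrow> 'y pmf) \<Rightarrow> ('k::finite \<Rightarrow> ('x, 'y) past set)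
    \<Rightarrow> 'k \<Rightarrow> ('x, 'y, 'k) memory" where
  "qstate p s i = tensor (qstate_factor p s i)"

definition qstate_of_past ::
  "(('x::finite, 'y::finite) past \<Rightarrow> 'x \<Rightarrow> 'y pmf) \<Rightarrow> ('k::finite \<Rightarrow> ('x, 'y) past set)
    \<Rightarrow> ('x, 'y) past \<Rightarrow> ('x, 'y, 'k) memory" where
  "qstate_of_past p s z = qstate p s (THE k. causal_map p z = s k)"

type_synonym 'm operator = "complex ^ 'm ^ 'm"

definition ketbra :: "complex ^ 'm \<Rightarrow> 'm::finite operator" where
  "ketbra v = (\<chi> a b. v $ a * cnj (v $ b))"

definition scale_op :: "complex \<Rightarrow> 'm::finite operator \<Rightarrow> 'm operator" where
  "scale_op c A = map_matrix ((*) c) A"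

definition complex_linear :: "('m::finite operator \<Rightarrow> 'm operator) \<Rightarrow> bool" where
  "complex_linear \<Phi> \<longleftrightarrow> (\<forall>A B. \<Phi> (A + B) = \<Phi> A + \<Phi> B) \<and> (\<forall>c A. \<Phi> (scale_op c A) = scale_op c (\<Phi> A))"

text \<open>
  An operator on the tensor product of \<open>complex ^ 'm\<close> with a \<open>d\<close>-dimensional ancilla is a
  \<open>d \<times> d\<close> block matrix of operators \<open>A i j\<close> (\<open>i, j < d\<close>); the tensor product of \<open>\<Phi>\<close> with the
  identity on the ancilla acts blockwise.
\<close>

definition block_positive :: "nat \<Rightarrow> (nat \<Rightarrow> nat \<Rightarrow> 'm::finite operator) \<Rightarrow> bool" where
  "block_positive d A \<longleftrightarrow>
     (\<forall>v :: nat \<Rightarrow> complex ^ 'm.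
        (\<Sum>i<d. \<Sum>j<d. \<Sum>a\<in>UNIV. \<Sum>b\<in>UNIV. cnj (v i $ a) * A i j $ a $ b * v j $ b) \<in> \<real>\<^sub>\<ge>\<^sub>0)"

definition completely_positive :: "('m::finite operator \<Rightarrow> 'm operator) \<Rightarrow> bool" where
  "completely_positive \<Phi> \<longleftrightarrow>
     complex_linear \<Phi> \<and> (\<forall>d A. block_positive d A \<longrightarrow> block_positive d (\<lambda>i j. \<Phi> (A i j)))"

definition trace_preserving :: "('m::finite operator \<Rightarrow> 'm operator) \<Rightarrow> bool" where
  "trace_preserving \<Phi> \<longleftrightarrow> (\<forall>A. trace (\<Phi> A) = trace A)"

definition quantum_instrument :: "('y::finite \<Rightarrow> 'm::finite operator \<Rightarrow> 'm operator) \<Rightarrow> bool" where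
  "quantum_instrument \<M> \<longleftrightarrow>
     (\<forall>y. completely_positive (\<M> y)) \<and> trace_preserving (\<lambda>A. \<Sum>y\<in>UNIV. \<M> y A)"

definition outcome_prob :: "('m::finite operator \<Rightarrow> 'm operator) \<Rightarrow> 'm operator \<Rightarrow> complex" where
  "outcome_prob \<Phi> \<rho> = trace (\<Phi> \<rho>)"

definition post_state :: "('m::finite operator \<Rightarrow> 'm operator) \<Rightarrow> 'm operator \<Rightarrow> 'm operator" where
  "post_state \<Phi> \<rho> = scale_op (inverse (outcome_prob \<Phi> \<rho>)) (\<Phi> \<rho>)"

primrec sequential ::
  "('x \<Rightarrow> 'y \<Rightarrow> 'm::finite operator \<Rightarrow> 'm operator) \<Rightarrow> (nat \<Rightarrow> 'x) \<Rightarrow> (nat \<Rightarrow> 'y) \<Rightarrow> nat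
    \<Rightarrow> 'm operator \<Rightarrow> 'm operator" where
  "sequential \<M> xs ys 0 \<rho> = \<rho>"
| "sequential \<M> xs ys (Suc n) \<rho> = \<M> (xs n) (ys n) (sequential \<M> xs ys n \<rho>)"

text \<open>
  The output sequence of the sequential application of the instruments has law \<open>N\<close>: the
  probability of the first \<open>n\<close> outputs is the trace of the composed (unnormalized) maps.
\<close>

definition generates ::
  "('x \<Rightarrow> 'y \<Rightarrow> 'm::finite operator \<Rightarrow> 'm operator) \<Rightarrow> 'm operator \<Rightarrow> (nat \<Rightarrow> 'x)
    \<Rightarrow> (nat \<Rightarrow> 'y) measure \<Rightarrow> bool" where
  "generates \<M> \<rho> xs N \<longleftrightarrow>
     prob_space N \<and> sets N = sets seq_space \<and>
     (\<forall>n w. outcome_prob (sequential \<M> xs w n) \<rho> =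
        complex_of_real (measure N {ys \<in> space N. \<forall>t<n. ys t = w t}))"

end

theory Submission
  imports Defs
begin

text \<open>
  The instrument \<open>\<M> x\<close> measures the tensor factor with index \<open>x\<close> of the memory in the product
  basis, outputs the first component \<open>y\<close> of the result \<open>(y, k)\<close> and prepares the quantum causal
  state of \<open>k\<close> afresh. On the quantum causal state of \<open>i\<close> the result \<open>(y, k)\<close> has the transition
  element as its probability; since the past and the pair \<open>(x, y)\<close> determine the next causal state,
  only one \<open>k\<close> is possible for each \<open>y\<close>, so conditioning on \<open>y\<close> alone leaves a pure state.
\<close>

section \<open>Scalar multiples, traces, and weighted sums over the product basis\<close>

lemma scale_op_nth [simp]: "scale_op c A $ a $ b = c * A $ a $ b"
  by (simp add: scale_op_def map_matrix_def)

lemma ketbra_nth [simp]: "ketbra v $ a $ b = v $ a * cnj (v $ b)"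
  by (simp add: ketbra_def)

lemma trace_scale_op: "trace (scale_op c A) = c * trace A"
  by (simp add: trace_def sum_distrib_left)

lemma scale_op_scale_op: "scale_op c (scale_op d A) = scale_op (c * d) A"
  by (simp add: vec_eq_iff mult.assoc)

lemma scale_op_1 [simp]: "scale_op 1 A = A"
  by (simp add: vec_eq_iff)

lemma complex_linear_scale_op: "complex_linear \<Phi> \<Longrightarrow> \<Phi> (scale_op c A) = scale_op c (\<Phi> A)"
  by (simp add: complex_linear_def)

lemma trace_ketbra: "trace (ketbra v) = (\<Sum>a\<in>UNIV. v $ a * cnj (v $ a))"
  by (simp add: trace_def)

text \<open>Marginalization: with \<open>g\<close> absorbed into the weight at \<open>x\<close>,
  distributivity turns the sum over functions into a product of sums, and every factor other than
  \<open>x\<close> is 1. It shows that looking at one factor of a product state sees only the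
  weights of that factor.\<close>

lemma sum_functions_prod_marginal:
  fixes w :: "'x::finite \<Rightarrow> 'a::finite \<Rightarrow> 'b::comm_semiring_1"
  assumes "\<And>x'. x' \<noteq> x \<Longrightarrow> (\<Sum>c\<in>UNIV. w x' c) = 1"
  shows "(\<Sum>f\<in>UNIV. (\<Prod>x'\<in>UNIV. w x' (f x')) * g (f x)) = (\<Sum>c\<in>UNIV. w x c * g c)"
proof -
  define u where "u x' c = (if x' = x then w x' c * g c else w x' c)" for x' c
  have "(\<Prod>x'\<in>UNIV. w x' (f x')) * g (f x) = (\<Prod>x'\<in>UNIV. u x' (f x'))" for f
    unfolding prod.remove[OF finite UNIV_I[of x]] u_def by (simp add: ac_simps)
  then have "(\<Sum>f\<in>UNIV. (\<Prod>x'\<in>UNIV. w x' (f x')) * g (f x)) = (\<Sum>f\<in>UNIV. \<Prod>x'\<in>UNIV. u x' (f x'))"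
    by simp
  also have "\<dots> = (\<Prod>x'\<in>UNIV. \<Sum>c\<in>UNIV. u x' c)"
    using prod_sum_PiE[of "UNIV :: 'x set" "\<lambda>_. UNIV :: 'a set" u] by simp
  also have "\<dots> = (\<Sum>c\<in>UNIV. w x c * g c)"
    unfolding prod.remove[OF finite UNIV_I[of x]] by (simp add: u_def assms)
  finally show ?thesis .
qed

lemma trace_ketbra_tensor:
  assumes "\<And>x. trace (ketbra (v x)) = 1"
  shows "trace (ketbra (tensor v)) = 1"
  \<comment> \<open>All factors are normalized, so the singled-out one is arbitrary.\<close>
  using assms sum_functions_prod_marginal[of undefined "\<lambda>x c. v x $ c * cnj (v x $ c)" "\<lambda>_. 1"]
  by (simp add: trace_ketbra tensor_def prod.distrib)


section \<open>Measure-and-prepare instruments\<close>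

text \<open>The maps with Kraus operators \<open>|q f><f|\<close>, grouped by the label
  \<open>h f\<close>: an entanglement-breaking instrument.\<close>

definition measure_prepare ::
  "('m::finite \<Rightarrow> 'y) \<Rightarrow> ('m \<Rightarrow> complex ^ 'm) \<Rightarrow> 'y \<Rightarrow> 'm operator \<Rightarrow> 'm operator" where
  "measure_prepare h q y A = (\<Sum>f | h f = y. scale_op (A $ f $ f) (ketbra (q f)))"

lemma measure_prepare_nth:
  "measure_prepare h q y A $ a $ b = (\<Sum>f | h f = y. A $ f $ f * (q f $ a * cnj (q f $ b)))"
  by (simp add: measure_prepare_def sum_component)

lemma complex_linear_measure_prepare: "complex_linear (measure_prepare h q y)"
  by (simp add: complex_linear_def vec_eq_iff measure_prepare_nth sum.distrib sum_distrib_left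
      algebra_simps)

lemma sum_in_nonneg_Reals:
  "(\<And>i. i \<in> I \<Longrightarrow> g i \<in> \<real>\<^sub>\<ge>\<^sub>0) \<Longrightarrow> (\<Sum>i\<in>I. g i) \<in> \<real>\<^sub>\<ge>\<^sub>0"
  by (induction I rule: infinite_finite_induct) auto

text \<open>Test vectors along a single basis direction turn block positivity of \<open>A\<close>
  into positivity of the matrix of its \<open>f\<close>-th diagonal entries.\<close>

lemma sum_axis_sandwich:
  "(\<Sum>a\<in>UNIV. \<Sum>b\<in>UNIV. cnj (axis f x $ a) * M $ a $ b * axis f y $ b) = cnj x * M $ f $ f * y"
proof -
  have "cnj (axis f x $ a) * M $ a $ b * axis f y $ b =
      (if a = f then if b = f then cnj x * M $ f $ f * y else 0 else 0)" for a b
    by (auto simp: axis_def)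
  then have "(\<Sum>b\<in>UNIV. cnj (axis f x $ a) * M $ a $ b * axis f y $ b) =
      (if a = f then cnj x * M $ f $ f * y else 0)" for a
    by simp
  then show ?thesis
    by simp
qed

text \<open>The usual Kraus argument: the quadratic form of the image at \<open>v\<close> is a sum
  over \<open>f\<close> of the quadratic form of \<open>A\<close> at the vectors obtained by
  applying the adjoint \<open>|f><q f|\<close> to each \<open>v i\<close>.\<close>

lemma completely_positive_measure_prepare: "completely_positive (measure_prepare h q y)"
  unfolding completely_positive_def block_positive_def
proof (intro conjI allI impI complex_linear_measure_prepare)
  fix d :: nat and A :: "nat \<Rightarrow> nat \<Rightarrow> 'a operator" and v :: "nat \<Rightarrow> complex ^ 'a"
  assume A: "\<forall>v. (\<Sum>i<d. \<Sum>j<d. \<Sum>a\<in>UNIV. \<Sum>b\<in>UNIV. cnj (v i $ a) * A i j $ a $ b * v j $ b) \<in> \<real>\<^sub>\<ge>\<^sub>0"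
  \<comment> \<open>The inner product of \<open>q f\<close> with \<open>v i\<close>; the adjoint
    Kraus operator sends \<open>v i\<close> to \<open>axis f (c f i)\<close>.\<close>
  define c where "c f i = (\<Sum>a\<in>UNIV. cnj (q f $ a) * v i $ a)" for f i
  have "(\<Sum>i<d. \<Sum>j<d. cnj (c f i) * A i j $ f $ f * c f j) \<in> \<real>\<^sub>\<ge>\<^sub>0" for f
    using A[rule_format, of "\<lambda>i. axis f (c f i)"] by (simp only: sum_axis_sandwich)
  then have "(\<Sum>f | h f = y. \<Sum>i<d. \<Sum>j<d. cnj (c f i) * A i j $ f $ f * c f j) \<in> \<real>\<^sub>\<ge>\<^sub>0"
    by (rule sum_in_nonneg_Reals)
  also have "(\<Sum>f | h f = y. \<Sum>i<d. \<Sum>j<d. cnj (c f i) * A i j $ f $ f * c f j) =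
      (\<Sum>i<d. \<Sum>j<d. \<Sum>f | h f = y. cnj (c f i) * A i j $ f $ f * c f j)"
    by (simp only: sum.swap[where A = "{..<d}" and B = "{f. h f = y}"])
  also have "\<dots> = (\<Sum>i<d. \<Sum>j<d. \<Sum>a\<in>UNIV. \<Sum>b\<in>UNIV.
      cnj (v i $ a) * measure_prepare h q y (A i j) $ a $ b * v j $ b)"
  proof ((rule sum.cong[OF refl])+)
    fix i j
    have "(\<Sum>a\<in>UNIV. \<Sum>b\<in>UNIV. cnj (v i $ a) * measure_prepare h q y (A i j) $ a $ b * v j $ b) =
      (\<Sum>a\<in>UNIV. \<Sum>b\<in>UNIV. \<Sum>f | h f = y.
        (q f $ a * cnj (v i $ a)) * A i j $ f $ f * (cnj (q f $ b) * v j $ b))"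
      by (simp add: measure_prepare_nth sum_distrib_left sum_distrib_right ac_simps)
    also have "\<dots> = (\<Sum>f | h f = y. \<Sum>a\<in>UNIV. \<Sum>b\<in>UNIV.
        (q f $ a * cnj (v i $ a)) * A i j $ f $ f * (cnj (q f $ b) * v j $ b))"
      by (simp only: sum.swap[where A = UNIV and B = "{f. h f = y}"])
    also have "\<dots> = (\<Sum>f | h f = y. cnj (c f i) * A i j $ f $ f * c f j)"
      by (simp add: c_def sum_distrib_right) (simp add: sum_distrib_left)
    finally show "(\<Sum>f | h f = y. cnj (c f i) * A i j $ f $ f * c f j) =
      (\<Sum>a\<in>UNIV. \<Sum>b\<in>UNIV. cnj (v i $ a) * measure_prepare h q y (A i j) $ a $ b * v j $ b)" ..
  qed
  finally show "(\<Sum>i<d. \<Sum>j<d. \<Sum>a\<in>UNIV. \<Sum>b\<in>UNIV.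
      cnj (v i $ a) * measure_prepare h q y (A i j) $ a $ b * v j $ b) \<in> \<real>\<^sub>\<ge>\<^sub>0" .
qed

lemma quantum_instrument_measure_prepare:
  fixes h :: "'m::finite \<Rightarrow> 'y::finite"
  assumes "\<And>f. trace (ketbra (q f)) = 1"
  shows "quantum_instrument (measure_prepare h q)"
  unfolding quantum_instrument_def trace_preserving_def
proof (intro conjI allI completely_positive_measure_prepare)
  fix A :: "'m operator"
  \<comment> \<open>The fibres of \<open>h\<close> partition the basis.\<close>
  have "(\<Sum>y\<in>UNIV. measure_prepare h q y A) = (\<Sum>f\<in>UNIV. scale_op (A $ f $ f) (ketbra (q f)))"
    using sum.group[of "UNIV :: 'm set" "UNIV :: 'y set" h] by (simp add: measure_prepare_def)
  also have "trace \<dots> = (\<Sum>a\<in>UNIV. \<Sum>f\<in>UNIV. A $ f $ f * (q f $ a * cnj (q f $ a)))"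
    by (simp add: trace_def sum_component)
  also have "\<dots> = (\<Sum>f\<in>UNIV. A $ f $ f * trace (ketbra (q f)))"
    by (subst sum.swap) (simp add: trace_ketbra sum_distrib_left)
  finally show "trace (\<Sum>y\<in>UNIV. measure_prepare h q y A) = trace A"
    unfolding assms by (simp add: trace_def)
qed


section \<open>Quantum causal states\<close>

lemma causal_map_in_causal_states: "causal_map p z \<in> causal_states p"
  by (simp add: causal_map_def causal_states_def quotientI)

lemma causal_map_eq:
  assumes "S \<in> causal_states p" "z \<in> S"
  shows "causal_map p z = S"
  using assms equiv_causal_equiv[of p] unfolding causal_states_def causal_map_def
  by (metis Image_singleton_iff equiv_class_eq quotientE)

lemma causal_states_nonempty: "S \<in> causal_states p \<Longrightarrow> S \<noteq> {}"
  unfolding causal_states_def by (metis equiv_causal_equiv in_quotient_imp_non_empty)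

section \<open>A fixed enumeration of the causal states and the weights of the quantum causal
  states\<close>

locale causal_enumeration =
  fixes p :: "('x::finite, 'y::finite) past \<Rightarrow> 'x \<Rightarrow> 'y pmf"
    and s :: "'k::finite \<Rightarrow> ('x, 'y) past set"
  assumes bij: "bij_betw s UNIV (causal_states p)"
begin

definition index :: "('x, 'y) past \<Rightarrow> 'k" where
  "index z = (THE k. causal_map p z = s k)"

lemma in_causal_states: "s k \<in> causal_states p"
  using bij by (auto simp: bij_betw_def)

lemma causal_map_eq_iff: "causal_map p z = s k \<longleftrightarrow> k = index z"
proof -
  have "causal_map p z \<in> range s"
    using bij causal_map_in_causal_states[of p z] by (simp add: bij_betw_def)
  moreover have "inj s"
    using bij by (simp add: bij_betw_def)
  ultimately have "\<exists>!k. causal_map p z = s k"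
    by (auto dest: injD)
  from theI'[OF this] this show ?thesis
    unfolding index_def by blast
qed

lemma mem_iff: "z \<in> s k \<longleftrightarrow> k = index z"
proof
  show "k = index z" if "z \<in> s k"
    using causal_map_eq[OF in_causal_states that] causal_map_eq_iff by blast
  have "z \<in> causal_map p z"
    by (simp add: causal_map_def causal_equiv_def)
  then show "z \<in> s k" if "k = index z"
    using that causal_map_eq_iff by blast
qed

text \<open>Causal states are nonempty classes. Facts about an arbitrary index thus reduce to a
  representative past, where transition elements are values of a \<open>pmf\<close>.\<close>

lemma ex_past: "\<exists>z. k = index z"
  using causal_states_nonempty[OF in_causal_states[of k]] mem_iff by blast

lemma transition_index:
  "transition p s (index z) k y x = (if k = index (update_past x y z) then pmf (p z x) y else 0)"
  by (simp add: transition_eq[where z = z] in_causal_states mem_iff causal_map_eq_iff)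

lemma qstate_factor_nth:
  "qstate_factor p s i x $ (y, k) = complex_of_real (sqrt (transition p s i k y x))"
proof -
  have "qstate_factor p s i x $ (y, k) = (\<Sum>k'\<in>UNIV. \<Sum>y'\<in>UNIV.
      if y = y' then if k = k' then complex_of_real (sqrt (transition p s i k' y' x)) else 0 else 0)"
    unfolding qstate_factor_def sum_component by (intro sum.cong refl) (simp add: axis_def)
  then show ?thesis
    by simp
qed

text \<open>The representative past supplies nonnegativity, without which squaring would not undo
  \<open>sqrt\<close>.\<close>

lemma qstate_factor_nth_square:
  "qstate_factor p s i x $ (y, k) * cnj (qstate_factor p s i x $ (y, k)) =
    complex_of_real (transition p s i k y x)"
proof -
  obtain z where "i = index z" using ex_past by blast
  then have "0 \<le> transition p s i k y x"
    by (simp add: transition_index)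
  then show ?thesis
    by (simp add: qstate_factor_nth flip: of_real_mult)
qed

text \<open>Expectation of \<open>g\<close> under a measurement of the factor \<open>x\<close>. For
  each \<open>y\<close> only the updated causal state contributes, so the sum over \<open>k\<close>
  collapses. The choice \<open>g = 1\<close> gives normalization.\<close>

lemma sum_qstate_factor:
  "(\<Sum>c\<in>UNIV. qstate_factor p s (index z) x $ c * cnj (qstate_factor p s (index z) x $ c) * g c) =
    (\<Sum>y\<in>UNIV. complex_of_real (pmf (p z x) y) * g (y, index (update_past x y z)))"
proof -
  have "(\<Sum>c\<in>UNIV. qstate_factor p s (index z) x $ c * cnj (qstate_factor p s (index z) x $ c) * g c) =
    (\<Sum>y\<in>UNIV. \<Sum>k\<in>UNIV. complex_of_real (transition p s (index z) k y x) * g (y, k))"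
    unfolding UNIV_Times_UNIV[symmetric] sum.cartesian_product
    by (rule sum.cong) (auto simp: qstate_factor_nth_square)
  also have "\<dots> = (\<Sum>y\<in>UNIV. complex_of_real (pmf (p z x) y) * g (y, index (update_past x y z)))"
    by (simp add: transition_index if_distrib if_distribR cong: if_cong)
  finally show ?thesis .
qed

lemma trace_ketbra_qstate_factor: "trace (ketbra (qstate_factor p s i x)) = 1"
proof -
  obtain z where "i = index z" using ex_past by blast
  then show ?thesis
    using sum_qstate_factor[of z x "\<lambda>_. 1"] sum_pmf_eq_1[of UNIV "p z x"]
    by (simp add: trace_ketbra flip: of_real_sum)
qed

lemma trace_ketbra_qstate: "trace (ketbra (qstate p s i)) = 1"
  unfolding qstate_def by (rule trace_ketbra_tensor[OF trace_ketbra_qstate_factor])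

lemma qstate_of_past_index: "qstate_of_past p s z = qstate p s (index z)"
  by (simp add: qstate_of_past_def index_def)

lemma trace_ketbra_qstate_of_past: "trace (ketbra (qstate_of_past p s z)) = 1"
  by (simp add: qstate_of_past_index trace_ketbra_qstate)

text \<open>A basis vector of the memory is a function \<open>f\<close> on inputs. All factors are
  measured but only \<open>f x\<close> is used, which has the same effect as measuring the factor
  \<open>x\<close> alone, because the whole memory is prepared afresh.\<close>

definition instr ::
  "'x \<Rightarrow> 'y \<Rightarrow> ('x \<Rightarrow> 'y \<times> 'k) operator \<Rightarrow> ('x \<Rightarrow> 'y \<times> 'k) operator" where
  "instr x = measure_prepare (\<lambda>f. fst (f x)) (\<lambda>f. qstate p s (snd (f x)))"

lemma quantum_instrument_instr: "quantum_instrument (instr x)"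
  unfolding instr_def by (rule quantum_instrument_measure_prepare[OF trace_ketbra_qstate])

text \<open>The key identity. Since the prepared operator has trace 1, the scalar is the outcome
  probability and the operator is the state left behind; it also covers outcomes of probability
  zero.\<close>

lemma instr_qstate:
  "instr x y (ketbra (qstate_of_past p s z)) =
    scale_op (complex_of_real (pmf (p z x) y)) (ketbra (qstate_of_past p s (update_past x y z)))"
proof (unfold vec_eq_iff, intro allI)
  fix a b
  let ?q = "\<lambda>k. qstate p s k"
  let ?v = "qstate_factor p s (index z)"
  \<comment> \<open>The restriction to output \<open>y\<close> moves into \<open>g\<close>, so that
    the sum can run over all \<open>f\<close>.\<close>
  define g where "g c = (if fst c = y then ?q (snd c) $ a * cnj (?q (snd c) $ b) else 0)" for c :: "'y \<times> 'k"
  have "instr x y (ketbra (qstate_of_past p s z)) $ a $ b =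
      (\<Sum>f | fst (f x) = y. (?q (index z) $ f * cnj (?q (index z) $ f)) *
        (?q (snd (f x)) $ a * cnj (?q (snd (f x)) $ b)))"
    by (simp add: instr_def measure_prepare_nth qstate_of_past_index)
  also have "\<dots> = (\<Sum>f\<in>UNIV. (?q (index z) $ f * cnj (?q (index z) $ f)) * g (f x))"
    by (rule sum.mono_neutral_cong_left) (auto simp: g_def)
  also have "\<dots> = (\<Sum>f\<in>UNIV. (\<Prod>x'\<in>UNIV. ?v x' $ f x' * cnj (?v x' $ f x')) * g (f x))"
    by (simp add: qstate_def tensor_def prod.distrib)
  also have "\<dots> = (\<Sum>c\<in>UNIV. ?v x $ c * cnj (?v x $ c) * g c)"
    by (rule sum_functions_prod_marginal) (simp add: trace_ketbra_qstate_factor flip: trace_ketbra)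
  also have "\<dots> = complex_of_real (pmf (p z x) y) * g (y, index (update_past x y z))"
    unfolding sum_qstate_factor by (simp add: g_def if_distrib cong: if_cong)
  finally show "instr x y (ketbra (qstate_of_past p s z)) $ a $ b =
    scale_op (complex_of_real (pmf (p z x) y))
      (ketbra (qstate_of_past p s (update_past x y z))) $ a $ b"
    by (simp add: g_def qstate_of_past_index)
qed

lemma outcome_prob_instr:
  "outcome_prob (instr x y) (ketbra (qstate_of_past p s z)) = complex_of_real (pmf (p z x) y)"
  by (simp add: outcome_prob_def instr_qstate trace_scale_op trace_ketbra_qstate_of_past)

lemma post_state_instr:
  assumes "pmf (p z x) y \<noteq> 0"
  shows "post_state (instr x y) (ketbra (qstate_of_past p s z)) =
    ketbra (qstate_of_past p s (update_past x y z))"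
  using assms
  by (simp add: post_state_def outcome_prob_instr instr_qstate scale_op_scale_op flip: of_real_inverse of_real_mult)

text \<open>Linearity carries the accumulated scalar through each further map. Working without
  normalization avoids dividing by the probability of an impossible prefix.\<close>

lemma sequential_instr:
  "sequential instr xs w n (ketbra (qstate_of_past p s z)) =
    scale_op (complex_of_real (\<Prod>t<n. pmf (p (past_after z xs w t) (xs t)) (w t)))
      (ketbra (qstate_of_past p s (past_after z xs w n)))"
proof (induction n)
  case (Suc n)
  have "complex_linear (instr x y)" for x y
    unfolding instr_def by (rule complex_linear_measure_prepare)
  with Suc show ?case
    by (simp add: complex_linear_scale_op instr_qstate scale_op_scale_op)
qed simp

text \<open>The trace of the composed maps is the product of one-step probabilities, which is also
  the cylinder value of \<open>cond_law\<close>.\<close>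

lemma generates_instr: "generates instr (ketbra (qstate_of_past p s z)) xs (cond_law p z xs)"
proof -
  have "space (cond_law p z xs) = UNIV"
    using sets_eq_imp_space_eq[OF sets_cond_law[of p z xs]] by (simp add: space_PiM)
  then show ?thesis
    by (simp add: generates_def prob_space_cond_law sets_cond_law measure_cond_law_cylinder
        outcome_prob_def sequential_instr trace_scale_op trace_ketbra_qstate_of_past)
qed

end

theorem mainTheorem1:
  fixes law :: "(int \<Rightarrow> 'x::finite) \<Rightarrow> (int \<Rightarrow> 'y::finite) measure"
    and p :: "('x, 'y) past \<Rightarrow> 'x \<Rightarrow> 'y pmf"
    and s :: "'k::finite \<Rightarrow> ('x, 'y) past set"
  assumes "io_process law p"
    and "bij_betw s UNIV (causal_states p)"
  shows "\<exists>\<M> :: 'x \<Rightarrow> 'y \<Rightarrow> ('x \<Rightarrow> 'y \<times> 'k) operator \<Rightarrow> ('x \<Rightarrow> 'y \<times> 'k) operator.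
    (\<forall>x. quantum_instrument (\<M> x)) \<and>
    (\<forall>i. \<forall>z \<in> s i.
      (\<forall>x y.
        outcome_prob (\<M> x y) (ketbra (qstate p s i)) = complex_of_real (pmf (p z x) y) \<and>
        (pmf (p z x) y \<noteq> 0 \<longrightarrow>
          post_state (\<M> x y) (ketbra (qstate p s i)) =
            ketbra (qstate_of_past p s (update_past x y z)))) \<and>
      (\<forall>xs. generates \<M> (ketbra (qstate p s i)) xs (cond_law p z xs)))"
proof -
  interpret causal_enumeration p s
    by unfold_locales (rule assms(2))
  \<comment> \<open>The initial state depends only on the class, so the results for a single past
    apply to every past in \<open>s i\<close> with the same \<open>instr\<close>.\<close>
  have "qstate p s i = qstate_of_past p s z" if "z \<in> s i" for i z
    using that by (simp add: qstate_of_past_index mem_iff)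
  then show ?thesis
    using quantum_instrument_instr outcome_prob_instr post_state_instr generates_instr
    by (intro exI[of _ instr]) simp
qed

end
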